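(* Let $n\ge2$ and $\beta\ge2$, and define $\underline{\alpha}^*_{\Delta^n}(\beta)$ as the largest solution $\alpha$ of $\varphi_n(\alpha)=\varphi_n(\beta)$. Then $\underline{\alpha}^*_{\Delta^n}(\beta)\le\alpha_{\Delta^n}(\beta)$, where $\alpha_{\Delta^n}(\beta)$ is the simplex transition threshold.
   Context: For $\gamma>0$, $\varphi_n(\gamma):=-\left(\frac{(n+1)(2n-2+2^{\gamma/2})}{2n^2}\right)^{1/\gamma}$. $\mathcal{P}(\mathbb{R}^n)$ is the set of Borel probability measures on $\mathbb{R}^n$; for $\alpha>\beta>0$, $\mathcal{E}_{\alpha,\beta}[\mu]=\frac12\iint_{\mathbb{R}^n\times\mathbb{R}^n}\left(\frac{|x-y|^\alpha}{\alpha}-\frac{|x-y|^\beta}{\beta}\right)d\mu(x)d\mu(y)$. A unit simplex (measure) is the uniform probability measure on $n+1$ points of $\mathbb{R}^n$ with all pairwise distances equal to $1$. The simplex transition threshold $\alpha_{\Delta^n}(\beta)\in[\beta,\infty)$, for $\beta\ge2$, is the (known to exist, unique) number such that: for every $\alpha>\alpha_{\Delta^n}(\beta)$, $\mathcal{E}_{\alpha,\beta}$ is minimized over $\mathcal{P}(\mathbb{R}^n)$ exactly by unit simplices (i.e. uniquely up to translation and rotation), and for every $\alpha$ with $\beta<\alpha<\alpha_{\Delta^n}(\beta)$, unit simplices do not minimize $\mathcal{E}_{\alpha,\beta}$ over $\mathcal{P}(\mathbb{R}^n)$. *)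

theory Defs
  imports "HOL-Probability.Probability"
begin

definition phi :: "nat \<Rightarrow> real \<Rightarrow> real" where
  "phi n \<gamma> =
     - (((real n + 1) * (2 * real n - 2 + 2 powr (\<gamma> / 2)) / (2 * (real n)\<^sup>2)) powr (1 / \<gamma>))"

text \<open>The function \<open>phi n\<close> is only considered on the positive half-line, so solutions are
  sought there.\<close>

definition largest_solution :: "nat \<Rightarrow> real \<Rightarrow> real" where
  "largest_solution n \<beta> = (GREATEST \<alpha>. 0 < \<alpha> \<and> phi n \<alpha> = phi n \<beta>)"

definition borel_probs :: "(real ^ 'n) measure set" where
  "borel_probs = {\<mu>. prob_space \<mu> \<and> sets \<mu> = sets borel}"

definition interaction_kernel :: "real \<Rightarrow> real \<Rightarrow> real ^ 'n \<Rightarrow> real ^ 'n \<Rightarrow> real" where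
  "interaction_kernel \<alpha> \<beta> x y = norm (x - y) powr \<alpha> / \<alpha> - norm (x - y) powr \<beta> / \<beta>"

text \<open>Measures without enough moments have energy \<open>\<infinity>\<close>, so the integral is the extended one:
  positive part minus negative part. For \<open>\<alpha> > \<beta> > 0\<close> the kernel is bounded below,
  hence the subtracted term is finite for every probability measure.\<close>

definition energy :: "real \<Rightarrow> real \<Rightarrow> (real ^ 'n) measure \<Rightarrow> ereal" where
  "energy \<alpha> \<beta> \<mu> = ereal (1 / 2) *
     (enn2ereal (\<integral>\<^sup>+ z. ennreal (interaction_kernel \<alpha> \<beta> (fst z) (snd z)) \<partial>(\<mu> \<Otimes>\<^sub>M \<mu>))
      - enn2ereal (\<integral>\<^sup>+ z. ennreal (- interaction_kernel \<alpha> \<beta> (fst z) (snd z)) \<partial>(\<mu> \<Otimes>\<^sub>M \<mu>)))"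

definition is_energy_minimizer :: "real \<Rightarrow> real \<Rightarrow> (real ^ 'n) measure \<Rightarrow> bool" where
  "is_energy_minimizer \<alpha> \<beta> \<mu> \<longleftrightarrow>
     \<mu> \<in> borel_probs \<and> (\<forall>\<nu> \<in> (borel_probs :: (real ^ 'n) measure set). energy \<alpha> \<beta> \<mu> \<le> energy \<alpha> \<beta> \<nu>)"

definition unit_simplices :: "(real ^ 'n) measure set" where
  "unit_simplices = {distr (measure_pmf (pmf_of_set S)) borel (\<lambda>x. x) | S.
     finite S \<and> card S = CARD('n) + 1 \<and> (\<forall>x\<in>S. \<forall>y\<in>S. x \<noteq> y \<longrightarrow> dist x y = 1)}"

text \<open>Any two unit simplices differ by a translation and a rotation (reflections permute the
  vertices of a simplex), so minimality exactly on \<open>unit_simplices\<close> is uniqueness up to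
  translation and rotation. The two clauses below determine \<open>a\<close> uniquely.\<close>

definition is_simplex_threshold :: "'n::finite itself \<Rightarrow> real \<Rightarrow> real \<Rightarrow> bool" where
  "is_simplex_threshold _ \<beta> a \<longleftrightarrow>
     \<beta> \<le> a \<and>
     (\<forall>\<alpha>>a. {\<mu> :: (real ^ 'n) measure. is_energy_minimizer \<alpha> \<beta> \<mu>} = unit_simplices) \<and>
     (\<forall>\<alpha>. \<beta> < \<alpha> \<and> \<alpha> < a \<longrightarrow>
        (\<forall>\<mu> \<in> (unit_simplices :: (real ^ 'n) measure set). \<not> is_energy_minimizer \<alpha> \<beta> \<mu>))"

end

theory Submission
  imports Defs
begin

text \<open>
  The cross-polytope (the \<open>2n\<close> points \<open>\<plusminus>e\<^sub>i\<close>, rescaled) is compared with the unit simplex. With edge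
  length \<open>l\<close>, the uniform measure on its vertices has mean \<open>\<gamma>\<close>-th power of the distance
  \<open>l powr \<gamma> * (2n - 2 + 2 powr (\<gamma> / 2)) / (2n)\<close>, because each vertex sees \<open>2n - 2\<close> others at distance
  \<open>l\<close> and its antipode at distance \<open>l * sqrt 2\<close>; for the unit simplex the mean is \<open>n / (n + 1)\<close>. The
  quotient of the two for \<open>l = 1\<close> is \<open>(- phi n \<gamma>) powr \<gamma>\<close>.

  With \<open>l = - 1 / phi n \<beta>\<close> the two measures have the same \<open>\<beta>\<close>-mean, so their energies are ordered as
  their \<open>\<alpha>\<close>-means, and the cross-polytope has at most the energy of the simplex if and only if
  \<open>phi n \<beta> \<le> phi n \<alpha>\<close>. Above the threshold the unit simplices are minimizers and nothing else is. As
  \<open>2n > n + 1\<close> for \<open>n \<ge> 2\<close>, the cross-polytope is not a unit simplex, so \<open>phi n \<alpha> < phi n \<beta>\<close> for every \<open>\<alpha>\<close> above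
  the threshold (\<open>phi_less_above_threshold\<close>). No solution of \<open>phi n \<alpha> = phi n \<beta>\<close> therefore exceeds the
  threshold. It remains to see that a largest solution exists: \<open>\<beta>\<close> is one, and the solutions between
  \<open>\<beta>\<close> and the threshold form a compact set, since \<open>phi n\<close> is continuous.
\<close>

section \<open>Uniform measures on finite sets\<close>

definition uniform_on :: "(real ^ 'n) set \<Rightarrow> (real ^ 'n) measure" where
  "uniform_on S = distr (measure_pmf (pmf_of_set S)) borel (\<lambda>x. x)"

definition mean_distance_powr :: "real \<Rightarrow> (real ^ 'n) set \<Rightarrow> real" where
  "mean_distance_powr \<gamma> S = (\<Sum>x\<in>S. \<Sum>y\<in>S. dist x y powr \<gamma>) / (real (card S))\<^sup>2"

lemma uniform_on_in_borel_probs: "uniform_on S \<in> borel_probs"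
  unfolding uniform_on_def borel_probs_def
  by (auto intro!: prob_space.prob_space_distr measure_pmf.prob_space_axioms)

lemma measure_uniform_on_singleton:
  assumes "finite S" "S \<noteq> {}"
  shows "measure (uniform_on S) {x} = indicator S x / card S"
  unfolding uniform_on_def
  using assms by (simp add: measure_distr measure_pmf_single)

text \<open>The measure determines the number of points, since an atom has mass \<open>1 / card S\<close>.\<close>

lemma card_eq_if_uniform_on_eq:
  assumes "finite S" "S \<noteq> {}" "finite T" "T \<noteq> {}" and eq: "uniform_on S = uniform_on T"
  shows "card S = card T"
proof -
  obtain x where x: "x \<in> S"
    using assms by auto
  have "indicator S x / real (card S) = indicator T x / real (card T)"
    using measure_uniform_on_singleton[of S x] measure_uniform_on_singleton[of T x] assms by simp
  moreover have "card S > 0"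
    using assms by (simp add: card_gt_0_iff)
  ultimately show ?thesis
    using x by (cases "x \<in> T") (auto simp: field_simps)
qed

lemma nn_integral_uniform_on_pair:
  fixes f :: "real ^ 'n \<Rightarrow> real ^ 'n \<Rightarrow> real"
  assumes S: "finite S" "S \<noteq> {}"
    and f: "(\<lambda>z. f (fst z) (snd z)) \<in> borel_measurable (borel \<Otimes>\<^sub>M borel)"
  shows "(\<integral>\<^sup>+ z. ennreal (f (fst z) (snd z)) \<partial>(uniform_on S \<Otimes>\<^sub>M uniform_on S)) =
    ennreal ((\<Sum>x\<in>S. \<Sum>y\<in>S. max 0 (f x y)) / (real (card S))\<^sup>2)"
proof -
  let ?U = "uniform_on S"
  let ?c = "real (card S)"
  have c: "?c > 0"
    using S by (simp add: card_gt_0_iff)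
  have sets [measurable_cong]: "sets ?U = sets borel"
    by (simp add: uniform_on_def)
  interpret U: prob_space ?U
    using uniform_on_in_borel_probs[of S] by (simp add: borel_probs_def)
  have fU: "(\<lambda>z. ennreal (f (fst z) (snd z))) \<in> borel_measurable (?U \<Otimes>\<^sub>M ?U)"
    using f by (intro measurable_compose[OF _ measurable_ennreal])
      (simp cong: measurable_cong_sets add: sets sets_pair_measure_cong[OF sets sets])
  have average: "(\<integral>\<^sup>+ x. g x \<partial>?U) = (\<Sum>x\<in>S. g x) / ennreal ?c"
    if "g \<in> borel_measurable borel" for g :: "real ^ 'n \<Rightarrow> ennreal"
    unfolding uniform_on_def using that S
    by (simp add: nn_integral_distr nn_integral_pmf_of_set ennreal_of_nat_eq_real_of_nat)
  have inner: "(\<integral>\<^sup>+ y. ennreal (f x y) \<partial>?U) = ennreal ((\<Sum>y\<in>S. max 0 (f x y)) / ?c)" for x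
  proof -
    have "(\<lambda>y. f x y) \<in> borel_measurable borel"
      using measurable_compose[OF measurable_Pair1'[of x borel borel] f] by simp
    then have "(\<integral>\<^sup>+ y. ennreal (f x y) \<partial>?U) = (\<Sum>y\<in>S. ennreal (f x y)) / ennreal ?c"
      by (intro average) simp
    also have "(\<Sum>y\<in>S. ennreal (f x y)) = (\<Sum>y\<in>S. ennreal (max 0 (f x y)))"
      by (simp add: ennreal_max_0)
    also have "\<dots> = ennreal (\<Sum>y\<in>S. max 0 (f x y))"
      by (rule sum_ennreal) simp
    finally show ?thesis
      using c by (simp add: divide_ennreal sum_nonneg)
  qed
  have "(\<integral>\<^sup>+ z. ennreal (f (fst z) (snd z)) \<partial>(?U \<Otimes>\<^sub>M ?U)) = (\<integral>\<^sup>+ x. (\<integral>\<^sup>+ y. ennreal (f x y) \<partial>?U) \<partial>?U)"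
    using U.nn_integral_fst[OF fU] by simp
  also have "\<dots> = (\<Sum>x\<in>S. \<integral>\<^sup>+ y. ennreal (f x y) \<partial>?U) / ennreal ?c"
    using U.borel_measurable_nn_integral_fst[OF fU]
    by (intro average) (simp add: uniform_on_def)
  also have "\<dots> = ennreal (\<Sum>x\<in>S. (\<Sum>y\<in>S. max 0 (f x y)) / ?c) / ennreal ?c"
    unfolding inner by (subst sum_ennreal) (auto intro!: sum_nonneg divide_nonneg_nonneg)
  also have "\<dots> = ennreal ((\<Sum>x\<in>S. \<Sum>y\<in>S. max 0 (f x y)) / ?c\<^sup>2)"
    using c by (subst divide_ennreal)
      (auto intro!: sum_nonneg divide_nonneg_nonneg simp: power2_eq_square simp flip: sum_divide_distrib)
  finally show ?thesis .
qed

lemma interaction_kernel_measurable: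
  "(\<lambda>z :: (real ^ 'n) \<times> (real ^ 'n). interaction_kernel \<alpha> \<beta> (fst z) (snd z))
    \<in> borel_measurable (borel \<Otimes>\<^sub>M borel)"
  unfolding interaction_kernel_def by measurable

text \<open>On a finite set the integrals of the positive and of the negative part of the kernel are both finite,
  so the extended difference is the ordinary one.\<close>

lemma energy_uniform_on:
  fixes S :: "(real ^ 'n) set"
  assumes S: "finite S" "S \<noteq> {}"
  shows "energy \<alpha> \<beta> (uniform_on S) =
    ereal (1 / 2 * (mean_distance_powr \<alpha> S / \<alpha> - mean_distance_powr \<beta> S / \<beta>))"
proof -
  let ?K = "interaction_kernel \<alpha> \<beta> :: real ^ 'n \<Rightarrow> _"
  let ?P = "(\<Sum>x\<in>S. \<Sum>y\<in>S. max 0 (?K x y)) / (real (card S))\<^sup>2"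
  let ?N = "(\<Sum>x\<in>S. \<Sum>y\<in>S. max 0 (- ?K x y)) / (real (card S))\<^sup>2"
  have "energy \<alpha> \<beta> (uniform_on S) = ereal (1 / 2) * (ereal ?P - ereal ?N)"
    unfolding energy_def
    using nn_integral_uniform_on_pair[OF S, of ?K]
      nn_integral_uniform_on_pair[OF S, of "\<lambda>x y. - ?K x y"]
    by (simp add: interaction_kernel_measurable enn2ereal_ennreal sum_nonneg)
  also have "\<dots> = ereal (1 / 2 * (?P - ?N))"
    by simp
  also have "?P - ?N = (\<Sum>x\<in>S. \<Sum>y\<in>S. max 0 (?K x y) - max 0 (- ?K x y)) / (real (card S))\<^sup>2"
    by (simp add: sum_subtractf diff_divide_distrib)
  also have "(\<Sum>x\<in>S. \<Sum>y\<in>S. max 0 (?K x y) - max 0 (- ?K x y)) = (\<Sum>x\<in>S. \<Sum>y\<in>S. ?K x y)"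
    by (intro sum.cong) (auto simp: max_def)
  also have "\<dots> = (\<Sum>x\<in>S. \<Sum>y\<in>S. dist x y powr \<alpha>) / \<alpha> - (\<Sum>x\<in>S. \<Sum>y\<in>S. dist x y powr \<beta>) / \<beta>"
    by (simp add: interaction_kernel_def dist_norm sum_subtractf sum_divide_distrib)
  finally show ?thesis
    by (simp add: mean_distance_powr_def diff_divide_distrib mult.commute)
qed

section \<open>The unit simplex\<close>

lemma unit_simplices_eq:
  "(unit_simplices :: (real ^ 'n) measure set) =
    {uniform_on S | S. finite S \<and> card S = CARD('n) + 1 \<and> (\<forall>x\<in>S. \<forall>y\<in>S. x \<noteq> y \<longrightarrow> dist x y = 1)}"
  unfolding unit_simplices_def uniform_on_def by simp

text \<open>Only an existing simplex can have its energy compared with that of the cross-polytope. The vertices are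
  the points \<open>e\<^sub>i / sqrt 2\<close> and one further point on the diagonal.\<close>

lemma unit_simplex_exists:
  "\<exists>S :: (real ^ 'n) set.
    finite S \<and> card S = CARD('n) + 1 \<and> (\<forall>x\<in>S. \<forall>y\<in>S. x \<noteq> y \<longrightarrow> dist x y = 1)"
proof -
  let ?n = "real CARD('n)"
  define b :: real where "b = 1 / sqrt 2"
  \<comment> \<open>The positive root of \<open>n * c^2 - 2 * b * c + b^2 = 1\<close>: the apex has distance 1 from the other
    vertices.\<close>
  define c where "c = b * (1 + sqrt (?n + 1)) / ?n"
  define p :: "real ^ 'n" where "p = (\<chi> i. c)"
  define e :: "'n \<Rightarrow> real ^ 'n" where "e i = axis i b" for i
  have b: "b * b = 1 / 2"
    by (simp add: b_def)
  have n: "?n > 0"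
    by simp
  have root: "?n * c * c - 2 * b * c = 1 / 2"
  proof -
    have "?n * c * c - 2 * b * c = b * b * ((1 + sqrt (?n + 1)) * (1 + sqrt (?n + 1)) - 2 * (1 + sqrt (?n + 1))) / ?n"
      using n by (simp add: c_def field_simps)
    also have "(1 + sqrt (?n + 1)) * (1 + sqrt (?n + 1)) - 2 * (1 + sqrt (?n + 1)) = ?n"
      by (simp add: algebra_simps)
    finally show ?thesis
      using n b by simp
  qed
  have ee: "e i \<bullet> e j = (if i = j then 1 / 2 else 0)" for i j
    by (simp add: e_def inner_axis_axis b)
  have pe: "p \<bullet> e i = b * c" for i
    by (simp add: p_def e_def inner_axis)
  have pp: "p \<bullet> p = ?n * c * c"
    by (simp add: p_def inner_vec_def)
  have dee: "dist (e i) (e j) = 1" if "i \<noteq> j" for i j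
    using that unfolding dist_norm norm_eq_sqrt_inner
    by (simp add: inner_diff_left inner_diff_right ee)
  have dpe: "dist p (e i) = 1" for i
    using root unfolding dist_norm norm_eq_sqrt_inner
    by (simp add: inner_diff_left inner_diff_right ee pe pp inner_commute[of "e i" p])
  have dep: "dist (e i) p = 1" for i
    using dpe by (simp add: dist_commute)
  have dee': "dist (e i) (e j) = 1" if "e i \<noteq> e j" for i j
    using dee that by (cases "i = j") auto
  have "inj e"
    using dee by (metis dist_self injI zero_neq_one)
  then have "card (range e) = CARD('n)"
    by (simp add: card_image)
  moreover have "p \<notin> range e"
    using dpe by (metis dist_self imageE zero_neq_one)
  ultimately have "card (insert p (range e)) = CARD('n) + 1"
    by simp
  moreover have "\<forall>x\<in>insert p (range e). \<forall>y\<in>insert p (range e). x \<noteq> y \<longrightarrow> dist x y = 1"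
    using dee' dpe dep by auto
  ultimately show ?thesis
    by (intro exI[of _ "insert p (range e)"]) simp
qed

lemma mean_distance_powr_unit_simplex:
  fixes S :: "(real ^ 'n) set"
  assumes "finite S" "card S = CARD('n) + 1" "\<forall>x\<in>S. \<forall>y\<in>S. x \<noteq> y \<longrightarrow> dist x y = 1"
  shows "mean_distance_powr \<gamma> S = real CARD('n) / (real CARD('n) + 1)"
proof -
  have "(\<Sum>y\<in>S. dist x y powr \<gamma>) = CARD('n)" if "x \<in> S" for x
  proof -
    have "(\<Sum>y\<in>S. dist x y powr \<gamma>) = (\<Sum>y\<in>S - {x}. dist x y powr \<gamma>)"
      using that assms by (subst sum.remove[of _ x]) auto
    also have "\<dots> = (\<Sum>y\<in>S - {x}. 1)"
      using that assms by (intro sum.cong) auto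
    also have "\<dots> = CARD('n)"
      using that assms by simp
    finally show ?thesis .
  qed
  then have "(\<Sum>x\<in>S. \<Sum>y\<in>S. dist x y powr \<gamma>) = (real CARD('n) + 1) * CARD('n)"
    using assms by (simp add: algebra_simps)
  moreover have "real CARD('n) + 1 \<noteq> 0"
    by (metis of_nat_Suc of_nat_neq_0 add.commute)
  ultimately show ?thesis
    using assms by (simp add: mean_distance_powr_def power2_eq_square add.commute)
qed

section \<open>The cross-polytope\<close>

text \<open>The vertices are parametrized by an axis and a sign; \<open>l\<close> is the edge length.\<close>

definition cross_polytope_vertex :: "real \<Rightarrow> 'n::finite \<times> real \<Rightarrow> real ^ 'n" where
  "cross_polytope_vertex l = (\<lambda>(i, s). axis i (s * l / sqrt 2))"

definition cross_polytope :: "real \<Rightarrow> (real ^ 'n::finite) set" where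
  "cross_polytope l = cross_polytope_vertex l ` (UNIV \<times> {1, -1})"

lemma dist_cross_polytope_vertices:
  assumes "l > 0" "s \<in> {1, -1}" "t \<in> {1, -1}"
  shows "dist (cross_polytope_vertex l (i, s)) (cross_polytope_vertex l (j, t)) =
    (if i \<noteq> j then l else if s \<noteq> t then sqrt 2 * l else 0)"
proof -
  let ?x = "cross_polytope_vertex l (i, s)" and ?y = "cross_polytope_vertex l (j, t)"
  have "(dist ?x ?y)\<^sup>2 = ?x \<bullet> ?x - 2 * (?x \<bullet> ?y) + ?y \<bullet> ?y"
    by (simp add: dist_norm power2_norm_eq_inner inner_diff_left inner_diff_right inner_commute[of ?y ?x])
  also have "\<dots> = (if i \<noteq> j then l\<^sup>2 else if s \<noteq> t then 2 * l\<^sup>2 else 0)"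
    using assms(2,3)
    by (auto simp: cross_polytope_vertex_def inner_axis_axis power2_eq_square)
  finally have "sqrt (if i \<noteq> j then l\<^sup>2 else if s \<noteq> t then 2 * l\<^sup>2 else 0) = dist ?x ?y"
    by (rule real_sqrt_unique) simp
  then show ?thesis
    using assms(1) by (auto simp: real_sqrt_mult split: if_splits)
qed

lemma inj_on_cross_polytope_vertex:
  assumes "l > 0"
  shows "inj_on (cross_polytope_vertex l :: 'n::finite \<times> real \<Rightarrow> real ^ 'n) (UNIV \<times> {1, -1})"
proof (rule inj_onI)
  fix v w :: "'n \<times> real"
  assume vw: "v \<in> UNIV \<times> {1, -1}" "w \<in> UNIV \<times> {1, -1}"
    and eq: "cross_polytope_vertex l v = cross_polytope_vertex l w"
  obtain i s j t where [simp]: "v = (i, s)" "w = (j, t)"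
    by (cases v, cases w)
  have "dist (cross_polytope_vertex l (i, s)) (cross_polytope_vertex l (j, t)) = 0"
    using eq by simp
  then show "v = w"
    using dist_cross_polytope_vertices[of l s t i j] vw assms by (auto split: if_splits)
qed

lemma card_cross_polytope:
  assumes "l > 0"
  shows "card (cross_polytope l :: (real ^ 'n) set) = 2 * CARD('n)"
  unfolding cross_polytope_def
  by (simp add: card_image[OF inj_on_cross_polytope_vertex[OF assms]] card_cartesian_product)

lemma mean_distance_powr_cross_polytope:
  assumes l: "l > 0"
  shows "mean_distance_powr \<gamma> (cross_polytope l :: (real ^ 'n) set) =
    l powr \<gamma> * (2 * real CARD('n) - 2 + 2 powr (\<gamma> / 2)) / (2 * CARD('n))"
proof -
  let ?V = "UNIV \<times> {1, -1} :: ('n \<times> real) set"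
  let ?v = "cross_polytope_vertex l :: 'n \<times> real \<Rightarrow> real ^ 'n"
  let ?n = "real CARD('n)"
  let ?r = "l powr \<gamma> * (2 * ?n - 2 + 2 powr (\<gamma> / 2))"
  have sqrt2: "sqrt 2 powr \<gamma> = 2 powr (\<gamma> / 2)"
    by (simp add: powr_half_sqrt[symmetric] powr_powr)
  have row: "(\<Sum>w\<in>?V. dist (?v v) (?v w) powr \<gamma>) = ?r" if v: "v \<in> ?V" for v
  proof -
    obtain i s where [simp]: "v = (i, s)" and s: "s \<in> {1, -1}"
      using v by auto
    have "(\<Sum>w\<in>?V. dist (?v v) (?v w) powr \<gamma>) =
        (\<Sum>j\<in>UNIV. \<Sum>t\<in>{1, -1}. dist (?v (i, s)) (?v (j, t)) powr \<gamma>)"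
      by (simp only: sum.cartesian_product) (simp add: case_prod_unfold)
    also have "\<dots> = (\<Sum>j\<in>UNIV. if j = i then 2 powr (\<gamma> / 2) * l powr \<gamma> else 2 * l powr \<gamma>)"
      using s l by (intro sum.cong) (auto simp: dist_cross_polytope_vertices powr_mult sqrt2)
    also have "\<dots> = 2 powr (\<gamma> / 2) * l powr \<gamma> + (\<Sum>j\<in>UNIV - {i}. 2 * l powr \<gamma>)"
      by (subst sum.remove[of _ i]) (auto intro!: sum.cong)
    also have "\<dots> = ?r"
      by (simp add: of_nat_diff Suc_le_eq algebra_simps)
    finally show ?thesis .
  qed
  have "(\<Sum>x\<in>(cross_polytope l :: (real ^ 'n) set). \<Sum>y\<in>cross_polytope l. dist x y powr \<gamma>) =
      (\<Sum>v\<in>?V. \<Sum>w\<in>?V. dist (?v v) (?v w) powr \<gamma>)"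
    unfolding cross_polytope_def
    by (simp add: sum.reindex[OF inj_on_cross_polytope_vertex[OF l]])
  also have "\<dots> = (\<Sum>v\<in>?V. ?r)"
    by (intro sum.cong row refl)
  also have "\<dots> = 2 * ?n * ?r"
    by (simp add: card_cartesian_product)
  finally show ?thesis
    using l by (simp add: mean_distance_powr_def card_cross_polytope power2_eq_square)
qed

section \<open>Comparison of the two energies\<close>

lemma neg_phi_pos:
  assumes "n \<ge> 1"
  shows "- phi n \<gamma> > 0"
proof -
  have "2 * real n - 2 + 2 powr (\<gamma> / 2) > 0"
    using assms by (intro add_nonneg_pos) auto
  then show ?thesis
    using assms by (simp add: phi_def)
qed

text \<open>This value is the quotient of the means of the cross-polytope of edge length 1 and of the unit
  simplex.\<close>

lemma neg_phi_powr:
  assumes "n \<ge> 1" "\<gamma> > 0"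
  shows "(- phi n \<gamma>) powr \<gamma> = (real n + 1) * (2 * real n - 2 + 2 powr (\<gamma> / 2)) / (2 * (real n)\<^sup>2)"
proof -
  have "2 * real n - 2 + 2 powr (\<gamma> / 2) > 0"
    using assms by (intro add_nonneg_pos) auto
  then show ?thesis
    using assms by (simp add: phi_def powr_powr)
qed

lemma mean_distance_powr_cross_polytope_phi:
  assumes "l > 0" "\<gamma> > 0"
  shows "mean_distance_powr \<gamma> (cross_polytope l :: (real ^ 'n) set) =
    real CARD('n) / (real CARD('n) + 1) * (l * - phi CARD('n) \<gamma>) powr \<gamma>"
proof -
  have n: "CARD('n) \<ge> 1"
    by (simp add: Suc_le_eq)
  have "(l * - phi CARD('n) \<gamma>) powr \<gamma> = l powr \<gamma> * (- phi CARD('n) \<gamma>) powr \<gamma>"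
    by (rule powr_mult)
  then show ?thesis
    using assms by (simp add: mean_distance_powr_cross_polytope neg_phi_powr[OF n]
        power2_eq_square field_simps add_pos_pos)
qed

text \<open>The edge length \<open>- 1 / phi n \<beta>\<close> makes the \<open>\<beta>\<close>-means equal, and the hypothesis on \<open>phi\<close> then orders
  the \<open>\<alpha>\<close>-means.\<close>

lemma energy_cross_polytope_le_simplex:
  assumes \<alpha>\<beta>: "\<alpha> > 0" "\<beta> > 0" and phi: "phi CARD('n) \<beta> \<le> phi CARD('n) \<alpha>"
    and \<mu>: "\<mu> \<in> (unit_simplices :: (real ^ 'n) measure set)"
  shows "energy \<alpha> \<beta> (uniform_on (cross_polytope (1 / - phi CARD('n) \<beta>) :: (real ^ 'n) set))
    \<le> energy \<alpha> \<beta> \<mu>"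
proof -
  let ?l = "1 / - phi CARD('n) \<beta>"
  let ?C = "cross_polytope ?l :: (real ^ 'n) set"
  let ?M = "real CARD('n) / (real CARD('n) + 1)"
  have n: "CARD('n) \<ge> 1"
    by (simp add: Suc_le_eq)
  have l: "?l > 0"
    using neg_phi_pos[OF n, of \<beta>] by simp
  have C: "finite ?C" "?C \<noteq> {}"
    by (auto simp: cross_polytope_def)
  obtain S :: "(real ^ 'n) set" where \<mu>_eq: "\<mu> = uniform_on S" and S: "finite S"
      "card S = CARD('n) + 1" "\<forall>x\<in>S. \<forall>y\<in>S. x \<noteq> y \<longrightarrow> dist x y = 1"
    using \<mu> unfolding unit_simplices_eq by blast
  have \<beta>_mean: "mean_distance_powr \<beta> ?C = ?M"
    using neg_phi_pos[OF n, of \<beta>] \<alpha>\<beta> l by (simp add: mean_distance_powr_cross_polytope_phi)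
  have "(?l * - phi CARD('n) \<alpha>) powr \<alpha> \<le> 1"
    using neg_phi_pos[OF n, of \<alpha>] neg_phi_pos[OF n, of \<beta>] phi \<alpha>\<beta>
    by (intro powr_le1) (auto simp: field_simps)
  then have "mean_distance_powr \<alpha> ?C \<le> ?M * 1"
    unfolding mean_distance_powr_cross_polytope_phi[OF l \<alpha>\<beta>(1)]
    by (rule mult_left_mono) simp
  then have "mean_distance_powr \<alpha> ?C / \<alpha> \<le> ?M / \<alpha>"
    using \<alpha>\<beta> by (intro divide_right_mono) auto
  then have "1 / 2 * (mean_distance_powr \<alpha> ?C / \<alpha> - mean_distance_powr \<beta> ?C / \<beta>)
      \<le> 1 / 2 * (?M / \<alpha> - ?M / \<beta>)"
    unfolding \<beta>_mean by (intro mult_left_mono diff_right_mono) simp_all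
  moreover have "S \<noteq> {}"
    using S by auto
  ultimately show ?thesis
    unfolding \<mu>_eq energy_uniform_on[OF C] energy_uniform_on[OF S(1) \<open>S \<noteq> {}\<close>]
      mean_distance_powr_unit_simplex[OF S] by (simp only: ereal_less_eq)
qed

lemma cross_polytope_not_unit_simplex:
  assumes "CARD('n::finite) \<ge> 2" "l > 0"
  shows "uniform_on (cross_polytope l) \<notin> (unit_simplices :: (real ^ 'n) measure set)"
proof
  assume "uniform_on (cross_polytope l) \<in> (unit_simplices :: (real ^ 'n) measure set)"
  then obtain S :: "(real ^ 'n) set" where S: "uniform_on (cross_polytope l) = uniform_on S"
      "finite S" "card S = CARD('n) + 1"
    unfolding unit_simplices_eq by blast
  have "S \<noteq> {}" "finite (cross_polytope l :: (real ^ 'n) set)" "cross_polytope l \<noteq> ({} :: (real ^ 'n) set)"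
    using S by (auto simp: cross_polytope_def)
  then have "card (cross_polytope l :: (real ^ 'n) set) = card S"
    using S by (intro card_eq_if_uniform_on_eq) auto
  then show False
    using S assms by (simp add: card_cross_polytope)
qed

text \<open>Otherwise the cross-polytope would be a second minimizer.\<close>

lemma phi_less_above_threshold:
  assumes n: "CARD('n::finite) \<ge> 2" and "\<beta> > 0" and threshold: "is_simplex_threshold TYPE('n) \<beta> a"
    and "\<alpha> > a"
  shows "phi CARD('n) \<alpha> < phi CARD('n) \<beta>"
proof (rule ccontr)
  assume "\<not> phi CARD('n) \<alpha> < phi CARD('n) \<beta>"
  then have phi: "phi CARD('n) \<beta> \<le> phi CARD('n) \<alpha>"
    by simp
  let ?l = "1 / - phi CARD('n) \<beta>"
  let ?C = "uniform_on (cross_polytope ?l) :: (real ^ 'n) measure"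
  have "\<alpha> > 0"
    using assms by (simp add: is_simplex_threshold_def)
  have minimizers: "{\<mu> :: (real ^ 'n) measure. is_energy_minimizer \<alpha> \<beta> \<mu>} = unit_simplices"
    using threshold \<open>\<alpha> > a\<close> by (simp add: is_simplex_threshold_def)
  obtain \<mu> :: "(real ^ 'n) measure" where \<mu>: "\<mu> \<in> unit_simplices"
    using unit_simplex_exists unfolding unit_simplices_eq by blast
  then have "is_energy_minimizer \<alpha> \<beta> \<mu>"
    using minimizers by auto
  moreover have "energy \<alpha> \<beta> ?C \<le> energy \<alpha> \<beta> \<mu>"
    by (intro energy_cross_polytope_le_simplex phi \<mu>) fact+
  ultimately have "is_energy_minimizer \<alpha> \<beta> ?C"
    unfolding is_energy_minimizer_def using uniform_on_in_borel_probs order_trans by blast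
  then have "?C \<in> unit_simplices"
    using minimizers by auto
  moreover have "?l > 0"
    using neg_phi_pos[of "CARD('n)" \<beta>] n by simp
  ultimately show False
    using cross_polytope_not_unit_simplex[OF n] by blast
qed

section \<open>The largest solution\<close>

lemma continuous_on_phi:
  assumes "n \<ge> 1" "A \<subseteq> {0<..}"
  shows "continuous_on A (phi n)"
proof -
  have "2 * real n - 2 + 2 powr (\<gamma> / 2) > 0" for \<gamma> :: real
    using assms by (intro add_nonneg_pos) auto
  then have "2 * real n - 2 + 2 powr (\<gamma> / 2) \<noteq> 0" for \<gamma> :: real
    by (metis less_irrefl)
  then show ?thesis
    unfolding phi_def using assms by (intro continuous_intros) auto
qed

text \<open>\<open>Greatest\<close> is an unspecified value unless a maximum exists. A bound on the solutions gives one: the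
  solutions in the compact interval from \<open>\<beta>\<close> to the bound form a compact set containing \<open>\<beta>\<close>.\<close>

lemma largest_solution_le:
  assumes "n \<ge> 1" "\<beta> > 0" and bound: "\<And>\<alpha>. \<alpha> > 0 \<Longrightarrow> phi n \<alpha> = phi n \<beta> \<Longrightarrow> \<alpha> \<le> a"
  shows "largest_solution n \<beta> \<le> a"
proof -
  let ?T = "{\<alpha> \<in> {\<beta>..a}. phi n \<alpha> = phi n \<beta>}"
  have "closed ?T"
    using assms by (intro continuous_closed_preimage_constant continuous_on_phi) auto
  moreover have "bounded ?T"
    by (rule bounded_subset[OF bounded_closed_interval[of \<beta> a]]) auto
  ultimately have "compact ?T"
    by (simp add: compact_eq_bounded_closed)
  moreover have "\<beta> \<in> ?T"
    using assms by auto
  ultimately obtain m where m: "m \<in> ?T" "\<And>\<alpha>. \<alpha> \<in> ?T \<Longrightarrow> \<alpha> \<le> m"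
    using compact_attains_sup[of ?T] by blast
  have "largest_solution n \<beta> = m"
    unfolding largest_solution_def
  proof (rule Greatest_equality)
    show "0 < m \<and> phi n m = phi n \<beta>"
      using m(1) \<open>\<beta> > 0\<close> by auto
  next
    fix \<alpha>
    assume \<alpha>: "0 < \<alpha> \<and> phi n \<alpha> = phi n \<beta>"
    show "\<alpha> \<le> m"
    proof (cases "\<alpha> < \<beta>")
      case True
      then show ?thesis
        using m(1) by auto
    next
      case False
      then show ?thesis
        using \<alpha> bound by (intro m(2)) auto
    qed
  qed
  then show ?thesis
    using m(1) by auto
qed

theorem proposition1p10:
  fixes \<beta> \<alpha>\<^sub>\<Delta> :: real
  assumes "CARD('n::finite) \<ge> 2"
    and "\<beta> \<ge> 2"
    and "is_simplex_threshold TYPE('n) \<beta> \<alpha>\<^sub>\<Delta>"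
  shows "largest_solution CARD('n) \<beta> \<le> \<alpha>\<^sub>\<Delta>"
proof (rule largest_solution_le)
  show "CARD('n) \<ge> 1" "\<beta> > 0"
    using assms by auto
  fix \<alpha>
  assume "phi CARD('n) \<alpha> = phi CARD('n) \<beta>"
  then show "\<alpha> \<le> \<alpha>\<^sub>\<Delta>"
    using phi_less_above_threshold[OF assms(1) _ assms(3), of \<alpha>] assms(2) by force
qed

end
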